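(* Let $(p_m)_{m\ge 0}$ be a sequence of positive real numbers with $P_m=p_0+p_1+\dots+p_m\to\infty$ as $m\to\infty$, and let $(u_m)_{m\ge 0}$ be any sequence of positive real numbers. Then, for $k\ge 1$, $|f(\overline{N}_p^u)|_k$ is a $BK$ space with respect to the norm $$\|a\|_{|f(\overline{N}_p^u)|_k}=\sup\left\{\sum_{m=0}^{\infty}u_m^{k-1}|F_{m,n}(a)|^k : n\in\mathbb{N}\right\}^{1/k}.$$
   Context: All sequences are sequences of complex numbers indexed by $0,1,2,\dots$, and $\mathbb{N}=\{0,1,2,\dots\}$; a series $\sum a_v$ is identified with its sequence of terms $a=(a_v)$. A $BK$ space $X$ is a Banach space that is a linear subspace of the space of all complex sequences, such that each coordinate map $X\to\mathbb{C}$, $x\mapsto x_n$, is continuous for all $n\ge 0$. Let $(p_n)$ be a sequence of positive real numbers with $P_n=p_0+\dots+p_n\to\infty$, and $(u_n)$ a sequence of positive real numbers. For a sequence $a=(a_v)_{v\ge 0}$ and $m,n\ge 0$ put $$F_{m,n}(a)=\begin{cases} a_n, & m=0,\\[2pt] \dfrac{p_m}{P_mP_{m-1}}\displaystyle\sum_{v=1}^{m}P_{v-1}a_{n+v}, & m\ge 1.\end{cases}$$ For $k\ge 1$, $|f(\overline{N}_p^u)|_k$ is the set of all complex sequences $a$ such that the series $\sum_{m=0}^{\infty}u_m^{k-1}|F_{m,n}(a)|^k$ converges uniformly in $n\ge 0$ (i.e. it converges for every $n$ and its tails $\sum_{m\ge M}u_m^{k-1}|F_{m,n}(a)|^k$ tend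 to $0$ as $M\to\infty$ uniformly in $n$). *)

theory Defs
  imports "HOL-Analysis.Analysis" "HOL-Library.Function_Algebras"
begin

text \<open>
  Addition, subtraction and zero of sequences are pointwise (from \<open>Function_Algebras\<close>).
\<close>

type_synonym cseq = "nat \<Rightarrow> complex"

definition scale_seq :: "complex \<Rightarrow> cseq \<Rightarrow> cseq" where
  "scale_seq c a = (\<lambda>n. c * a n)"

interpretation cseq: vector_space scale_seq
  by unfold_locales (auto simp: scale_seq_def fun_eq_iff algebra_simps)

text \<open>
  The norm is an arbitrary real function on all sequences, of which only the values on the
  carrier \<open>X\<close> matter.
\<close>

definition norm_on :: "cseq set \<Rightarrow> (cseq \<Rightarrow> real) \<Rightarrow> bool" where
  "norm_on X N \<longleftrightarrow>
     (\<forall>a\<in>X. 0 \<le> N a) \<and>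
     (\<forall>a\<in>X. N a = 0 \<longleftrightarrow> a = 0) \<and>
     (\<forall>c. \<forall>a\<in>X. N (scale_seq c a) = cmod c * N a) \<and>
     (\<forall>a\<in>X. \<forall>b\<in>X. N (a + b) \<le> N a + N b)"

text \<open>
  The locale \<open>Metric_space\<close> asks for a nonnegative and symmetric distance also off the carrier,
  hence the default value there.
\<close>

definition norm_dist :: "cseq set \<Rightarrow> (cseq \<Rightarrow> real) \<Rightarrow> cseq \<Rightarrow> cseq \<Rightarrow> real" where
  "norm_dist X N a b = (if a \<in> X \<and> b \<in> X then N (a - b) else 0)"

lemma Metric_space_norm_dist:
  assumes X: "cseq.subspace X" and N: "norm_on X N"
  shows "Metric_space X (norm_dist X N)"
proof
  have diff: "a - b \<in> X" if "a \<in> X" "b \<in> X" for a b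
    using cseq.subspace_diff[OF X that] .
  have sym: "N (a - b) = N (b - a)" if "a \<in> X" "b \<in> X" for a b
  proof -
    have "a - b = scale_seq (- 1) (b - a)"
      by (simp add: scale_seq_def fun_eq_iff)
    moreover have "N (scale_seq (- 1) (b - a)) = cmod (- 1) * N (b - a)"
      using N diff[OF that(2,1)] unfolding norm_on_def by blast
    ultimately show ?thesis by simp
  qed
  fix a b c
  show "0 \<le> norm_dist X N a b"
    using N diff[of a b] by (auto simp: norm_dist_def norm_on_def)
  show "norm_dist X N a b = norm_dist X N b a"
    using sym by (auto simp: norm_dist_def)
  show "(norm_dist X N a b = 0) = (a = b)" if "a \<in> X" "b \<in> X"
    using N diff[OF that] that by (auto simp: norm_dist_def norm_on_def)
  show "norm_dist X N a c \<le> norm_dist X N a b + norm_dist X N b c"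
    if "a \<in> X" "b \<in> X" "c \<in> X"
  proof -
    have "N ((a - b) + (b - c)) \<le> N (a - b) + N (b - c)"
      using N diff[OF that(1,2)] diff[OF that(2,3)] unfolding norm_on_def by blast
    then show ?thesis using that by (simp add: norm_dist_def)
  qed
qed

definition BK_space :: "cseq set \<Rightarrow> (cseq \<Rightarrow> real) \<Rightarrow> bool" where
  "BK_space X N \<longleftrightarrow>
     cseq.subspace X \<and>
     norm_on X N \<and>
     Metric_space.mcomplete X (norm_dist X N) \<and>
     (\<forall>n. continuous_map (Metric_space.mtopology X (norm_dist X N)) euclidean (\<lambda>x. x n))"

definition psum :: "(nat \<Rightarrow> real) \<Rightarrow> nat \<Rightarrow> real" where
  "psum p n = (\<Sum>i\<le>n. p i)"

definition F :: "(nat \<Rightarrow> real) \<Rightarrow> nat \<Rightarrow> nat \<Rightarrow> cseq \<Rightarrow> complex" where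
  "F p m n a =
     (if m = 0 then a n
      else of_real (p m / (psum p m * psum p (m - 1))) *
           (\<Sum>v=1..m. of_real (psum p (v - 1)) * a (n + v)))"

definition F_term ::
    "(nat \<Rightarrow> real) \<Rightarrow> (nat \<Rightarrow> real) \<Rightarrow> real \<Rightarrow> cseq \<Rightarrow> nat \<Rightarrow> nat \<Rightarrow> real" where
  "F_term p u k a m n = u m powr (k - 1) * cmod (F p m n a) powr k"

definition fN_space :: "(nat \<Rightarrow> real) \<Rightarrow> (nat \<Rightarrow> real) \<Rightarrow> real \<Rightarrow> cseq set" where
  "fN_space p u k = {a. uniformly_convergent_on UNIV (\<lambda>M n. \<Sum>m<M. F_term p u k a m n)}"

text \<open>
  The sums and the supremum are taken in \<open>[0, \<infinity>]\<close>, where they always exist. The default value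
  \<open>enn2real \<infinity> = 0\<close> cannot hide an infinite supremum: the supremum at the zero sequence is \<open>0\<close>,
  so a sequence with supremum \<open>\<infinity>\<close> would be nonzero with norm \<open>0\<close>, against definiteness.
\<close>

definition fN_norm :: "(nat \<Rightarrow> real) \<Rightarrow> (nat \<Rightarrow> real) \<Rightarrow> real \<Rightarrow> cseq \<Rightarrow> real" where
  "fN_norm p u k a = enn2real (SUP n. \<Sum>m. ennreal (F_term p u k a m n)) powr (1 / k)"

end

theory Submission
  imports Defs
begin

text \<open>
  Write \<open>Q A n a\<close> for the \<open>\<ell>\<^sub>k\<close>-norm of the weighted vector \<open>(F\<^sub>m\<^sub>,\<^sub>n(a))\<close> with \<open>m\<close> in a finite
  set \<open>A\<close>; by Minkowski's inequality it is a seminorm. Membership in the space says that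
  \<open>Q {M..<M'} n a\<close> is small for large \<open>M\<close>, uniformly in \<open>n\<close>, and the norm is the supremum of
  \<open>Q {..<M} n a\<close> over \<open>M\<close> and \<open>n\<close>. That supremum is finite: for all large \<open>m\<close> the values
  \<open>F\<^sub>m\<^sub>,\<^sub>n(a)\<close> are bounded in \<open>n\<close>, and for two consecutive \<open>m\<close> their weighted difference is a
  multiple of \<open>a\<^sub>n\<^sub>+\<^sub>m\<^sub>+\<^sub>1\<close>; so \<open>a\<close> is bounded, and then every \<open>F\<^sub>m\<^sub>,\<^sub>n(a)\<close> is bounded in \<open>n\<close>.
  The term \<open>m = 0\<close> of the norm controls the coordinates, so a Cauchy sequence converges
  coordinatewise, and both conditions pass to the limit through the finite blocks \<open>Q A n\<close>.
\<close>

section \<open>Minkowski's inequality for finite sums with a real exponent\<close>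

lemma powr_convex_combination:
  fixes x y t k :: real
  assumes "k \<ge> 1" "x \<ge> 0" "y \<ge> 0" "0 \<le> t" "t \<le> 1"
  shows "(t * x + (1 - t) * y) powr k \<le> t * x powr k + (1 - t) * y powr k"
proof -
  \<comment> \<open>If \<open>x\<close> or \<open>y\<close> is 0, the claim reduces to
    \<open>s powr k \<le> s\<close> on the unit interval. Convexity of \<open>powr\<close> is
    invoked only at positive arguments.\<close>
  have shrink: "(s * z) powr k \<le> s * z powr k" if "0 \<le> s" "s \<le> 1" for s z :: real
  proof -
    have "s powr k \<le> s powr 1"
      using that assms(1) by (intro powr_mono')
    then show ?thesis
      using that by (simp add: powr_mult mult_right_mono)
  qed
  consider "x = 0" | "y = 0" | "x > 0" "y > 0"
    using assms by linarith
  then show ?thesis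
  proof cases
    case 1
    then show ?thesis using shrink[of "1 - t" y] assms by simp
  next
    case 2
    then show ?thesis using shrink[of t x] assms by simp
  next
    case 3
    then show ?thesis
      using convex_onD[OF powr_convex[OF assms(1)], of "1 - t" x y] assms by simp
  qed
qed

text \<open>Normalise by the norms \<open>a\<close> of \<open>f\<close> and \<open>b\<close> of
  \<open>g\<close>: \<open>(f + g) / (a + b)\<close> is the convex combination of
  \<open>f / a\<close> and \<open>g / b\<close> with weight \<open>a / (a + b)\<close>, and
  convexity of the power applies in each entry. If a norm is 0, that vector vanishes on
  \<open>A\<close> and cannot be normalised, but the claim is then immediate.\<close>

lemma Minkowski_sum_powr:
  fixes f g :: "'a \<Rightarrow> real" and k :: real
  assumes "finite A" and k: "k \<ge> 1"
    and f: "\<And>i. i \<in> A \<Longrightarrow> 0 \<le> f i" and g: "\<And>i. i \<in> A \<Longrightarrow> 0 \<le> g i"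
  shows "(\<Sum>i\<in>A. (f i + g i) powr k) powr (1 / k)
    \<le> (\<Sum>i\<in>A. f i powr k) powr (1 / k) + (\<Sum>i\<in>A. g i powr k) powr (1 / k)"
proof -
  define a where "a = (\<Sum>i\<in>A. f i powr k) powr (1 / k)"
  define b where "b = (\<Sum>i\<in>A. g i powr k) powr (1 / k)"
  have ak: "a powr k = (\<Sum>i\<in>A. f i powr k)" and bk: "b powr k = (\<Sum>i\<in>A. g i powr k)"
    using k by (auto simp: a_def b_def powr_powr sum_nonneg)
  have nonneg: "a \<ge> 0" "b \<ge> 0"
    by (auto simp: a_def b_def)
  show ?thesis
  proof (cases "a = 0 \<or> b = 0")
    case True
    then show ?thesis
    proof
      assume "a = 0"
      then have "(\<Sum>i\<in>A. f i powr k) = 0"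
        using ak by simp
      then have "\<forall>i\<in>A. f i = 0"
        using assms(1) by (simp add: sum_nonneg_eq_0_iff)
      then show ?thesis by simp
    next
      assume "b = 0"
      then have "(\<Sum>i\<in>A. g i powr k) = 0"
        using bk by simp
      then have "\<forall>i\<in>A. g i = 0"
        using assms(1) by (simp add: sum_nonneg_eq_0_iff)
      then show ?thesis by simp
    qed
  next
    case False
    then have pos: "a > 0" "b > 0"
      using nonneg by auto
    define t where "t = a / (a + b)"
    have t: "0 \<le> t" "t \<le> 1" and t': "1 - t = b / (a + b)"
      using pos by (auto simp: t_def field_simps)
    have "(f i + g i) powr k
        \<le> (a + b) powr k * (t * (f i powr k / a powr k) + (1 - t) * (g i powr k / b powr k))"
      if "i \<in> A" for i
    proof -
      have "t * (f i / a) = f i / (a + b)" "(1 - t) * (g i / b) = g i / (a + b)"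
        using pos unfolding t' by (simp_all add: t_def)
      then have "f i + g i = (a + b) * (t * (f i / a) + (1 - t) * (g i / b))"
        using pos by (simp flip: add_divide_distrib)
      then have "(f i + g i) powr k = (a + b) powr k * (t * (f i / a) + (1 - t) * (g i / b)) powr k"
        by (simp add: powr_mult)
      also have "\<dots> \<le> (a + b) powr k * (t * (f i / a) powr k + (1 - t) * (g i / b) powr k)"
        using pos f[OF that] g[OF that] t k
        by (intro mult_left_mono powr_convex_combination) auto
      finally show ?thesis
        by (simp add: powr_divide)
    qed
    then have "(\<Sum>i\<in>A. (f i + g i) powr k)
        \<le> (\<Sum>i\<in>A. (a + b) powr k * (t * (f i powr k / a powr k) + (1 - t) * (g i powr k / b powr k)))"
      by (rule sum_mono)
    also have "\<dots> = (a + b) powr k *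
        (t * ((\<Sum>i\<in>A. f i powr k) / a powr k) + (1 - t) * ((\<Sum>i\<in>A. g i powr k) / b powr k))"
      by (simp add: sum_distrib_left sum.distrib sum_divide_distrib distrib_left)
    \<comment> \<open>Both normalised power sums equal 1, so the bracket is
      \<open>t + (1 - t) = 1\<close>.\<close>
    also have "\<dots> = (a + b) powr k"
      using pos unfolding ak[symmetric] bk[symmetric] by simp
    finally have "(\<Sum>i\<in>A. (f i + g i) powr k) powr (1 / k) \<le> ((a + b) powr k) powr (1 / k)"
      using k by (intro powr_mono2) (auto intro: sum_nonneg)
    then show ?thesis
      using k pos by (simp add: powr_powr a_def b_def)
  qed
qed

section \<open>Linearity and coordinatewise continuity of the transform\<close>

lemma F_add: "F p m n (a + b) = F p m n a + F p m n b"
  by (simp add: F_def algebra_simps sum.distrib)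

lemma F_scale: "F p m n (scale_seq c a) = c * F p m n a"
  by (simp add: F_def scale_seq_def sum_distrib_left mult_ac)

lemma F_zero [simp]: "F p m n 0 = 0"
  by (simp add: F_def)

lemma tendsto_F:
  assumes "\<And>j. (\<lambda>i. s i j) \<longlonglongrightarrow> a j"
  shows "(\<lambda>i. F p m n (s i)) \<longlonglongrightarrow> F p m n a"
proof (cases "m = 0")
  case True
  then show ?thesis by (simp add: F_def assms)
next
  case False
  show ?thesis
    unfolding F_def if_not_P[OF False]
    by (intro tendsto_mult tendsto_sum tendsto_const assms)
qed

section \<open>The seminorms \<open>Q A n\<close> of blocks of rows\<close>

locale riesz_weights =
  fixes p u :: "nat \<Rightarrow> real" and k :: real
  assumes p_pos: "p m > 0" and u_pos: "u m > 0" and k: "k \<ge> 1"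
begin

definition Q :: "nat set \<Rightarrow> nat \<Rightarrow> cseq \<Rightarrow> real" where
  "Q A n a = (\<Sum>m\<in>A. F_term p u k a m n) powr (1 / k)"

lemma psum_pos: "psum p m > 0"
  unfolding psum_def using p_pos by (intro sum_pos) auto

lemma F_term_nonneg [simp]: "0 \<le> F_term p u k a m n"
  by (simp add: F_term_def)

lemma sum_F_term_nonneg [simp]: "0 \<le> (\<Sum>m\<in>A. F_term p u k a m n)"
  by (simp add: sum_nonneg)

text \<open>Moving the weight inside the power exhibits \<open>Q\<close> as an unweighted finite
  norm of a rescaled vector, the shape Minkowski's inequality needs.\<close>

lemma F_term_eq_powr: "F_term p u k a m n = (u m powr ((k - 1) / k) * cmod (F p m n a)) powr k"
  using k by (simp add: F_term_def powr_mult powr_powr)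

lemma Q_nonneg [simp]: "0 \<le> Q A n a"
  by (simp add: Q_def)

lemma Q_powr: "Q A n a powr k = (\<Sum>m\<in>A. F_term p u k a m n)"
  using k by (simp add: Q_def powr_powr)

lemma Q_le_iff:
  assumes "r \<ge> 0"
  shows "Q A n a \<le> r \<longleftrightarrow> (\<Sum>m\<in>A. F_term p u k a m n) \<le> r powr k"
proof
  assume "Q A n a \<le> r"
  then show "(\<Sum>m\<in>A. F_term p u k a m n) \<le> r powr k"
    using powr_mono2[of k "Q A n a" r] k by (simp add: Q_powr)
next
  assume "(\<Sum>m\<in>A. F_term p u k a m n) \<le> r powr k"
  then have "Q A n a \<le> (r powr k) powr (1 / k)"
    unfolding Q_def using k by (intro powr_mono2) auto
  then show "Q A n a \<le> r"
    using k assms by (simp add: powr_powr)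
qed

lemma Q_mono: "finite B \<Longrightarrow> A \<subseteq> B \<Longrightarrow> Q A n a \<le> Q B n a"
  unfolding Q_def using k by (intro powr_mono2 sum_mono2) auto

lemma Q_zero [simp]: "Q A n 0 = 0"
  using k by (simp add: Q_def F_term_def)

lemma Q_scale: "Q A n (scale_seq c a) = cmod c * Q A n a"
proof -
  have "(\<Sum>m\<in>A. F_term p u k (scale_seq c a) m n) = cmod c powr k * (\<Sum>m\<in>A. F_term p u k a m n)"
    by (simp add: F_term_def F_scale norm_mult powr_mult sum_distrib_left mult_ac)
  then show ?thesis
    using k by (simp add: Q_def powr_mult powr_powr)
qed

text \<open>The triangle inequality in each row, followed by Minkowski's inequality over the
  rows.\<close>

lemma Q_add_le:
  assumes "finite A"
  shows "Q A n (a + b) \<le> Q A n a + Q A n b"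
proof -
  let ?w = "\<lambda>m. u m powr ((k - 1) / k)"
  have "Q A n (a + b)
      \<le> (\<Sum>m\<in>A. (?w m * cmod (F p m n a) + ?w m * cmod (F p m n b)) powr k) powr (1 / k)"
    unfolding Q_def F_term_eq_powr F_add using k
    by (intro powr_mono2 sum_mono sum_nonneg)
      (auto simp flip: distrib_left intro!: mult_left_mono norm_triangle_ineq)
  also have "\<dots> \<le> Q A n a + Q A n b"
    unfolding Q_def F_term_eq_powr by (intro Minkowski_sum_powr assms k) auto
  finally show ?thesis .
qed

text \<open>Carries block bounds to a coordinatewise limit. The bases may tend to 0, which is
  harmless since they are nonnegative and the exponents \<open>k\<close> and \<open>1 / k\<close>
  are positive.\<close>

lemma tendsto_Q:
  assumes "\<And>j. (\<lambda>i. s i j) \<longlonglongrightarrow> a j"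
  shows "(\<lambda>i. Q A n (s i)) \<longlonglongrightarrow> Q A n a"
  unfolding Q_def F_term_def using k
  by (intro tendsto_powr' tendsto_sum tendsto_mult tendsto_const tendsto_norm tendsto_F assms)
    (auto intro!: always_eventually sum_nonneg)

lemma Q_coordinate: "Q {..<1} n a = u 0 powr ((k - 1) / k) * cmod (a n)"
  using k by (simp add: Q_def F_term_eq_powr powr_powr F_def)

section \<open>Membership by uniformly small blocks, and the linear structure\<close>

lemma fN_space_iff:
  "a \<in> fN_space p u k \<longleftrightarrow> (\<forall>e>0. \<exists>M. \<forall>M' n. Q {M..<M'} n a \<le> e)"
proof -
  let ?S = "\<lambda>M n. \<Sum>m<M. F_term p u k a m n"
  have diff: "?S M' n - ?S M n = (\<Sum>m\<in>{M..<M'}. F_term p u k a m n)" if "M \<le> M'" for M M' n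
    using that sum_diff_nat_ivl[of 0 M M' "\<lambda>m. F_term p u k a m n"] by (simp add: lessThan_atLeast0)
  \<comment> \<open>Completeness of the reals removes the limit function, leaving differences of
    partial sums, which are \<open>k\<close>-th powers of block seminorms.\<close>
  have "a \<in> fN_space p u k \<longleftrightarrow> uniformly_Cauchy_on UNIV ?S"
    by (simp add: fN_space_def uniformly_convergent_eq_Cauchy)
  also have "\<dots> \<longleftrightarrow> (\<forall>e>0. \<exists>M. \<forall>M' n. Q {M..<M'} n a \<le> e)"
  proof
    assume C: "uniformly_Cauchy_on UNIV ?S"
    show "\<forall>e>0. \<exists>M. \<forall>M' n. Q {M..<M'} n a \<le> e"
    proof (intro allI impI)
      fix e :: real assume e: "e > 0"
      then have "e powr k > 0" by simp
      then obtain M where M: "\<And>n m m'. m \<ge> M \<Longrightarrow> m' \<ge> M \<Longrightarrow> dist (?S m n) (?S m' n) < e powr k"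
        using C unfolding uniformly_Cauchy_on_def by fast
      have "Q {M..<M'} n a \<le> e" for M' n
      proof (cases "M \<le> M'")
        case True
        have "dist (?S M' n) (?S M n) < e powr k"
          using M True by blast
        then show ?thesis
          using e by (simp add: Q_le_iff dist_real_def diff[OF True])
      next
        \<comment> \<open>Here the block is empty, so its seminorm is 0.\<close>
        case False
        then show ?thesis
          using e by (simp add: Q_le_iff)
      qed
      then show "\<exists>M. \<forall>M' n. Q {M..<M'} n a \<le> e" by blast
    qed
  next
    assume R: "\<forall>e>0. \<exists>M. \<forall>M' n. Q {M..<M'} n a \<le> e"
    show "uniformly_Cauchy_on UNIV ?S"
    proof (rule uniformly_Cauchy_onI')
      fix e :: real assume e: "e > 0"
      \<comment> \<open>Chosen so that \<open>d powr k = e / 2\<close>: the non-strict bound on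
        \<open>Q\<close> becomes the strict bound by \<open>e\<close>. Blocks starting after
        \<open>M\<close> are covered by monotonicity.\<close>
      define d where "d = (e / 2) powr (1 / k)"
      have d: "d > 0" "d powr k = e / 2"
        using e k by (auto simp: d_def powr_powr)
      obtain M where M: "\<And>M' n. Q {M..<M'} n a \<le> d"
        using R d by blast
      have "dist (?S m n) (?S m' n) < e" if "m \<ge> M" "m < m'" for n m m'
      proof -
        have "Q {m..<m'} n a \<le> Q {M..<m'} n a"
          using that by (intro Q_mono) auto
        also have "\<dots> \<le> d" by (rule M)
        finally have "?S m' n - ?S m n \<le> e / 2"
          using d that by (simp add: Q_le_iff diff)
        moreover have "?S m' n - ?S m n \<ge> 0"
          using that by (simp add: diff)
        ultimately show ?thesis
          using e by (simp add: dist_real_def)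
      qed
      then show "\<exists>M. \<forall>x\<in>UNIV. \<forall>m\<ge>M. \<forall>n>m. dist (?S m x) (?S n x) < e" by blast
    qed
  qed
  finally show ?thesis .
qed

lemma subspace_fN_space: "cseq.subspace (fN_space p u k)"
proof (rule cseq.subspaceI)
  show "0 \<in> fN_space p u k"
    by (auto simp: fN_space_iff intro: less_imp_le)
next
  fix a b assume a: "a \<in> fN_space p u k" and b: "b \<in> fN_space p u k"
  show "a + b \<in> fN_space p u k"
    unfolding fN_space_iff
  proof (intro allI impI)
    fix e :: real assume "e > 0"
    then have e: "e / 2 > 0" by simp
    obtain Ma where Ma: "\<And>M' n. Q {Ma..<M'} n a \<le> e / 2"
      using a e unfolding fN_space_iff by blast
    obtain Mb where Mb: "\<And>M' n. Q {Mb..<M'} n b \<le> e / 2"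
      using b e unfolding fN_space_iff by blast
    have "Q {max Ma Mb..<M'} n (a + b) \<le> e" for M' n
      using Q_add_le[of "{max Ma Mb..<M'}" n a b] Ma[of M' n] Mb[of M' n]
        Q_mono[of "{Ma..<M'}" "{max Ma Mb..<M'}" n a] Q_mono[of "{Mb..<M'}" "{max Ma Mb..<M'}" n b]
      by simp
    then show "\<exists>M. \<forall>M' n. Q {M..<M'} n (a + b) \<le> e" by blast
  qed
next
  fix c a assume a: "a \<in> fN_space p u k"
  show "scale_seq c a \<in> fN_space p u k"
    unfolding fN_space_iff
  proof (intro allI impI)
    fix e :: real assume e: "e > 0"
    \<comment> \<open>Adding 1 to \<open>cmod c\<close> keeps the denominator positive when
      \<open>c = 0\<close>.\<close>
    then have "e / (cmod c + 1) > 0"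
      by (simp add: add_nonneg_pos)
    then obtain M where M: "\<And>M' n. Q {M..<M'} n a \<le> e / (cmod c + 1)"
      using a unfolding fN_space_iff by blast
    have "Q {M..<M'} n (scale_seq c a) \<le> e" for M' n
    proof -
      have "Q {M..<M'} n (scale_seq c a) \<le> (cmod c + 1) * Q {M..<M'} n a"
        by (simp add: Q_scale mult_right_mono)
      also have "\<dots> \<le> (cmod c + 1) * (e / (cmod c + 1))"
        by (intro mult_left_mono M) auto
      also have "\<dots> = e"
        by (simp add: add_nonneg_eq_0_iff)
      finally show ?thesis .
    qed
    then show "\<exists>M. \<forall>M' n. Q {M..<M'} n (scale_seq c a) \<le> e" by blast
  qed
qed

section \<open>Boundedness of the members and finiteness of the supremum\<close>

lemma bounded_if_F_bounded:
  assumes m: "m \<ge> 1" and F1: "bounded (range (\<lambda>n. F p m n a))"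
    and F2: "bounded (range (\<lambda>n. F p (Suc m) n a))"
  shows "bounded (range a)"
proof -
  \<comment> \<open>The row \<open>F p j n a\<close> without its factor, which depends on
    \<open>j\<close> alone. This relation requires \<open>j \<ge> 1\<close>, as row 0 is defined
    separately.\<close>
  define G where "G j n = (\<Sum>v=1..j. of_real (psum p (v - 1)) * a (n + v))" for j n
  have G: "bounded (range (G j))" if "j \<ge> 1" "bounded (range (\<lambda>n. F p j n a))" for j
  proof -
    have "p j / (psum p j * psum p (j - 1)) \<noteq> 0"
      using p_pos[of j] psum_pos by (simp add: less_imp_neq[symmetric])
    then have "G j n = inverse (of_real (p j / (psum p j * psum p (j - 1)))) * F p j n a" for n
      using that(1) by (simp add: F_def G_def)
    then have "G j = (\<lambda>n. inverse (of_real (p j / (psum p j * psum p (j - 1)))) * F p j n a)" ..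
    moreover have "bounded (range (\<lambda>n. c * F p j n a))" for c
      using bounded_linear_image[OF that(2) bounded_linear_mult_right[of c]]
      by (simp add: image_image)
    ultimately show ?thesis by (simp only:)
  qed
  \<comment> \<open>The two sums share their first \<open>m\<close> summands; only
    \<open>v = Suc m\<close> survives, with coefficient \<open>psum p m\<close>.\<close>
  have a_eq: "a (n + Suc m) = inverse (of_real (psum p m)) * (G (Suc m) n - G m n)" for n
    using psum_pos[of m] by (simp add: G_def)
  obtain B1 where B1: "\<And>n. cmod (G m n) \<le> B1"
    using G[OF m F1] by (auto simp: bounded_iff)
  obtain B2 where B2: "\<And>n. cmod (G (Suc m) n) \<le> B2"
    using G[OF _ F2] by (auto simp: bounded_iff)
  have tail: "cmod (a (n + Suc m)) \<le> inverse (psum p m) * (B2 + B1)" for n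
  proof -
    have "cmod (a (n + Suc m)) = inverse (psum p m) * cmod (G (Suc m) n - G m n)"
      using psum_pos[of m] by (simp only: a_eq norm_mult norm_inverse norm_of_real abs_of_pos)
    also have "\<dots> \<le> inverse (psum p m) * (B2 + B1)"
      using psum_pos[of m] norm_triangle_ineq4[of "G (Suc m) n" "G m n"] B1[of n] B2[of n]
      by (intro mult_left_mono) auto
    finally show ?thesis .
  qed
  have "range a \<subseteq> a ` {..m} \<union> range (\<lambda>n. a (n + Suc m))"
  proof (rule image_subsetI)
    fix j
    show "a j \<in> a ` {..m} \<union> range (\<lambda>n. a (n + Suc m))"
    proof (cases "j \<le> m")
      case False
      then have "a j = a (j - Suc m + Suc m)" by simp
      then show ?thesis by (metis UnI2 rangeI)
    qed simp
  qed
  moreover have "bounded (range (\<lambda>n. a (n + Suc m)))"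
    using tail by (auto simp: bounded_iff)
  then have "bounded (a ` {..m} \<union> range (\<lambda>n. a (n + Suc m)))"
    by (simp add: finite_imp_bounded)
  ultimately show ?thesis
    using bounded_subset by blast
qed

text \<open>A row is a finite sum with coefficients independent of \<open>n\<close>. This controls
  the finitely many initial rows about which the uniform tail condition says nothing.\<close>

lemma bounded_imp_F_term_bounded:
  assumes "bounded (range a)"
  shows "\<exists>C. \<forall>n. F_term p u k a m n \<le> C"
proof -
  obtain B where B: "\<And>j. cmod (a j) \<le> B"
    using assms by (auto simp: bounded_iff)
  have "\<exists>D. \<forall>n. cmod (F p m n a) \<le> D"
  proof (cases "m = 0")
    case True
    then show ?thesis using B by (auto simp: F_def)
  next
    case False
    let ?c = "p m / (psum p m * psum p (m - 1))"
    have c: "?c > 0"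
      using p_pos[of m] psum_pos[of m] psum_pos[of "m - 1"] by simp
    have "cmod (F p m n a) \<le> ?c * (\<Sum>v=1..m. psum p (v - 1) * B)" for n
    proof -
      have "cmod (of_real (psum p (v - 1)) * a (n + v)) \<le> psum p (v - 1) * B" for v
        unfolding norm_mult norm_of_real using psum_pos[of "v - 1"] B[of "n + v"]
        by (simp only: abs_of_pos) (rule mult_left_mono, auto)
      then have "cmod (\<Sum>v=1..m. of_real (psum p (v - 1)) * a (n + v))
          \<le> (\<Sum>v=1..m. psum p (v - 1) * B)"
        by (rule sum_norm_le)
      then show ?thesis
        unfolding F_def if_not_P[OF False] norm_mult norm_of_real abs_of_pos[OF c]
        using c by (intro mult_left_mono) auto
    qed
    then show ?thesis by blast
  qed
  then obtain D where "\<And>n. cmod (F p m n a) \<le> D" by blast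
  then have "F_term p u k a m n \<le> u m powr (k - 1) * D powr k" for n
    unfolding F_term_def using k by (intro mult_left_mono powr_mono2) auto
  then show ?thesis by blast
qed

lemma fN_space_bounded:
  assumes "a \<in> fN_space p u k"
  shows "bounded (range a)"
proof -
  obtain M where M: "\<And>M' n. Q {M..<M'} n a \<le> 1"
    using assms[unfolded fN_space_iff, rule_format, OF zero_less_one] by blast
  have "bounded (range (\<lambda>n. F p m n a))" if "m \<ge> M" for m
  proof -
    have "cmod (F p m n a) \<le> inverse (u m powr ((k - 1) / k))" for n
    proof -
      have "u m powr ((k - 1) / k) * cmod (F p m n a) = Q {m} n a"
        using k by (simp add: Q_def F_term_eq_powr powr_powr)
      also have "\<dots> \<le> Q {M..<Suc m} n a"
        using that by (intro Q_mono) auto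
      also have "\<dots> \<le> 1" by (rule M)
      finally show ?thesis
        using u_pos[of m] by (simp add: field_simps)
    qed
    then show ?thesis by (auto simp: bounded_iff)
  qed
  \<comment> \<open>Rows \<open>Suc M\<close> and \<open>Suc (Suc M)\<close> are used so that the
    lower index is at least 1 even if \<open>M = 0\<close>.\<close>
  then show ?thesis
    using bounded_if_F_bounded[of "Suc M" a] by simp
qed

lemma sums_F_term_bounded:
  assumes "a \<in> fN_space p u k"
  shows "\<exists>B. \<forall>M n. (\<Sum>m<M. F_term p u k a m n) \<le> B"
proof -
  have "\<forall>m. \<exists>c. \<forall>n. F_term p u k a m n \<le> c"
    using bounded_imp_F_term_bounded[OF fN_space_bounded[OF assms]] by blast
  from choice[OF this] obtain C where C: "\<And>m n. F_term p u k a m n \<le> C m"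
    by blast
  obtain M0 where M0: "\<And>M' n. Q {M0..<M'} n a \<le> 1"
    using assms[unfolded fN_space_iff, rule_format, OF zero_less_one] by blast
  have "(\<Sum>m<M. F_term p u k a m n) \<le> (\<Sum>m<M0. C m) + 1" for M n
  proof -
    \<comment> \<open>Only an inequality, since \<open>M\<close> may be smaller than
      \<open>M0\<close>.\<close>
    have "(\<Sum>m<M. F_term p u k a m n) \<le> (\<Sum>m\<in>{..<M0} \<union> {M0..<M}. F_term p u k a m n)"
      by (intro sum_mono2) auto
    also have "\<dots> = (\<Sum>m<M0. F_term p u k a m n) + (\<Sum>m=M0..<M. F_term p u k a m n)"
      by (intro sum.union_disjoint) auto
    also have "\<dots> \<le> (\<Sum>m<M0. C m) + 1"
      using M0[of M n] by (intro add_mono sum_mono C) (simp add: Q_le_iff)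
    finally show ?thesis .
  qed
  then show ?thesis by blast
qed

text \<open>Reduces the extended-real supremum to finite blocks, so that the norm inherits the
  properties of \<open>Q\<close>. Membership guarantees a finite supremum.\<close>

lemma fN_norm_le_iff:
  assumes a: "a \<in> fN_space p u k" and r: "r \<ge> 0"
  shows "fN_norm p u k a \<le> r \<longleftrightarrow> (\<forall>M n. Q {..<M} n a \<le> r)"
proof -
  define S where "S = (SUP n. \<Sum>m. ennreal (F_term p u k a m n))"
  have S_le: "S \<le> ennreal c \<longleftrightarrow> (\<forall>M n. (\<Sum>m<M. F_term p u k a m n) \<le> c)" if "c \<ge> 0" for c
  proof -
    \<comment> \<open>A series of nonnegative terms is the supremum of its partial sums.\<close>
    have "S = (SUP n. SUP M. ennreal (\<Sum>m<M. F_term p u k a m n))"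
      unfolding S_def suminf_eq_SUP by (subst sum_ennreal) simp_all
    then have "S \<le> ennreal c \<longleftrightarrow> (\<forall>n M. ennreal (\<Sum>m<M. F_term p u k a m n) \<le> ennreal c)"
      by (simp only: SUP_le_iff ball_UNIV)
    then show ?thesis
      unfolding ennreal_le_iff[OF that] by blast
  qed
  obtain B where B: "\<And>M n. (\<Sum>m<M. F_term p u k a m n) \<le> B"
    using sums_F_term_bounded[OF a] by blast
  have "B \<ge> 0"
    using B[of 0 0] by simp
  \<comment> \<open>Finiteness of \<open>S\<close> excludes the default value of
    \<open>enn2real\<close> at infinity.\<close>
  then have "S \<le> ennreal B"
    using S_le B by blast
  then have "S < top"
    by (rule le_less_trans) simp
  then obtain s where s: "s \<ge> 0" "S = ennreal s"
    by (cases S) auto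
  have N: "fN_norm p u k a = s powr (1 / k)"
    unfolding fN_norm_def S_def[symmetric] s(2) enn2real_ennreal[OF s(1)] ..
  have "s powr (1 / k) \<le> r \<longleftrightarrow> s \<le> r powr k"
  proof
    assume "s powr (1 / k) \<le> r"
    then have "(s powr (1 / k)) powr k \<le> r powr k"
      using k by (intro powr_mono2) auto
    then show "s \<le> r powr k" using k s by (simp add: powr_powr)
  next
    assume "s \<le> r powr k"
    then have "s powr (1 / k) \<le> (r powr k) powr (1 / k)"
      using k s by (intro powr_mono2) auto
    then show "s powr (1 / k) \<le> r" using k r by (simp add: powr_powr)
  qed
  also have "\<dots> \<longleftrightarrow> S \<le> ennreal (r powr k)"
    unfolding s(2) by (rule ennreal_le_iff[symmetric]) simp
  also have "\<dots> \<longleftrightarrow> (\<forall>M n. Q {..<M} n a \<le> r)"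
    unfolding S_le[OF powr_ge_zero] Q_le_iff[OF r] ..
  finally show ?thesis unfolding N .
qed

section \<open>The norm axioms\<close>

lemma fN_norm_nonneg: "0 \<le> fN_norm p u k a"
  unfolding fN_norm_def by (rule powr_ge_zero)

lemma fN_norm_leI:
  assumes "a \<in> fN_space p u k" "r \<ge> 0" "\<And>M n. Q {..<M} n a \<le> r"
  shows "fN_norm p u k a \<le> r"
  unfolding fN_norm_le_iff[OF assms(1,2)] using assms(3) by simp

lemma Q_le_fN_norm:
  assumes "a \<in> fN_space p u k"
  shows "Q {..<M} n a \<le> fN_norm p u k a"
  using fN_norm_le_iff[OF assms fN_norm_nonneg, of a] by simp

lemma coordinate_le_fN_norm:
  assumes "a \<in> fN_space p u k"
  shows "u 0 powr ((k - 1) / k) * cmod (a n) \<le> fN_norm p u k a"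
  using Q_le_fN_norm[OF assms, of 1 n] unfolding Q_coordinate .

lemma norm_on_fN: "norm_on (fN_space p u k) (fN_norm p u k)"
  unfolding norm_on_def
proof (intro conjI ballI allI)
  fix a assume a: "a \<in> fN_space p u k"
  show "0 \<le> fN_norm p u k a" by (rule fN_norm_nonneg)
  show "fN_norm p u k a = 0 \<longleftrightarrow> a = 0"
  proof
    assume "fN_norm p u k a = 0"
    then have "u 0 powr ((k - 1) / k) * cmod (a n) \<le> 0" for n
      using coordinate_le_fN_norm[OF a, of n] by simp
    then have "a n = 0" for n
      using u_pos[of 0] by (simp add: mult_le_0_iff)
    then show "a = 0" by (intro ext) simp
  next
    assume "a = 0"
    then have "fN_norm p u k a \<le> 0"
      by (intro fN_norm_leI a) simp_all
    then show "fN_norm p u k a = 0"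
      using fN_norm_nonneg[of a] by (rule antisym)
  qed
  show "fN_norm p u k (a + b) \<le> fN_norm p u k a + fN_norm p u k b"
    if b: "b \<in> fN_space p u k" for b
  proof -
    have "Q {..<M} n (a + b) \<le> fN_norm p u k a + fN_norm p u k b" for M n
      using Q_add_le[of "{..<M}" n a b] Q_le_fN_norm[OF a, of M n] Q_le_fN_norm[OF b, of M n]
      by simp
    then show ?thesis
      by (intro fN_norm_leI cseq.subspace_add[OF subspace_fN_space a b]
          add_nonneg_nonneg fN_norm_nonneg)
  qed
  fix c
  have ca: "scale_seq c a \<in> fN_space p u k"
    by (rule cseq.subspace_scale[OF subspace_fN_space a])
  show "fN_norm p u k (scale_seq c a) = cmod c * fN_norm p u k a"
  proof (rule antisym)
    show "fN_norm p u k (scale_seq c a) \<le> cmod c * fN_norm p u k a"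
      by (intro fN_norm_leI ca mult_nonneg_nonneg norm_ge_zero fN_norm_nonneg)
        (unfold Q_scale, intro mult_left_mono Q_le_fN_norm a norm_ge_zero)
    \<comment> \<open>For nonzero \<open>c\<close>, dividing the block bounds for
      \<open>scale_seq c a\<close> by \<open>cmod c\<close> bounds every block of
      \<open>a\<close>.\<close>
    show "cmod c * fN_norm p u k a \<le> fN_norm p u k (scale_seq c a)"
    proof (cases "c = 0")
      case False
      have "Q {..<M} n a \<le> fN_norm p u k (scale_seq c a) / cmod c" for M n
        using Q_le_fN_norm[OF ca, of M n] False
        by (simp add: Q_scale pos_le_divide_eq mult.commute)
      then have "fN_norm p u k a \<le> fN_norm p u k (scale_seq c a) / cmod c"
        by (intro fN_norm_leI a divide_nonneg_nonneg norm_ge_zero fN_norm_nonneg)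
      then show ?thesis
        using False by (simp add: pos_le_divide_eq mult.commute)
    qed (simp add: fN_norm_nonneg)
  qed
qed

section \<open>The induced metric: continuity of coordinates and completeness\<close>

sublocale Metric_space "fN_space p u k" "norm_dist (fN_space p u k) (fN_norm p u k)"
  by (rule Metric_space_norm_dist[OF subspace_fN_space norm_on_fN])

lemma diff_in_fN_space:
  "a \<in> fN_space p u k \<Longrightarrow> b \<in> fN_space p u k \<Longrightarrow> a - b \<in> fN_space p u k"
  by (rule cseq.subspace_diff[OF subspace_fN_space])

lemma coordinate_dist:
  assumes "a \<in> fN_space p u k" "b \<in> fN_space p u k"
  shows "dist (a n) (b n)
    \<le> inverse (u 0 powr ((k - 1) / k)) * norm_dist (fN_space p u k) (fN_norm p u k) a b"
  using coordinate_le_fN_norm[OF diff_in_fN_space[OF assms], of n] assms u_pos[of 0]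
  by (simp add: norm_dist_def dist_norm field_simps)

lemma continuous_map_coordinate: "continuous_map mtopology euclidean (\<lambda>x. x n)"
proof -
  define w where "w = u 0 powr ((k - 1) / k)"
  have w: "w > 0" using u_pos[of 0] by (simp add: w_def)
  have "\<exists>d>0. \<forall>b. b \<in> fN_space p u k \<and> norm_dist (fN_space p u k) (fN_norm p u k) a b < d
      \<longrightarrow> dist (a n) (b n) < e" if "a \<in> fN_space p u k" "e > 0" for a e
  proof (intro exI conjI allI impI)
    \<comment> \<open>The radius compensates for the Lipschitz constant \<open>inverse w\<close> of
      the coordinate.\<close>
    show "w * e > 0" using w that by simp
    fix b assume b: "b \<in> fN_space p u k \<and> norm_dist (fN_space p u k) (fN_norm p u k) a b < w * e"
    have "dist (a n) (b n) \<le> inverse w * norm_dist (fN_space p u k) (fN_norm p u k) a b"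
      using coordinate_dist[of a b n] that b by (simp add: w_def)
    also have "\<dots> < e"
      using b w by (simp add: field_simps)
    finally show "dist (a n) (b n) < e" .
  qed
  then have "continuous_map mtopology Met_TC.mtopology (\<lambda>x. x n :: complex)"
    using metric_continuous_map[OF Met_TC.Metric_space_axioms, of "\<lambda>x. x n :: complex"] by auto
  then show ?thesis by simp
qed

lemma mcomplete_fN: mcomplete
  unfolding mcomplete_def
proof (intro allI impI)
  fix s assume "MCauchy s"
  then have s: "s i \<in> fN_space p u k" for i
    by (auto simp: MCauchy_def)
  have Cauchy: "\<exists>I. \<forall>i\<ge>I. \<forall>j\<ge>I. norm_dist (fN_space p u k) (fN_norm p u k) (s i) (s j) < e"
    if "e > 0" for e
  proof -
    from \<open>MCauchy s\<close> that obtain I where "\<forall>i j. I \<le> i \<longrightarrow> I \<le> j \<longrightarrow>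
        norm_dist (fN_space p u k) (fN_norm p u k) (s i) (s j) < e"
      unfolding MCauchy_def by force
    then show ?thesis by blast
  qed
  define w where "w = u 0 powr ((k - 1) / k)"
  have w: "w > 0" using u_pos[of 0] by (simp add: w_def)
  have "convergent (\<lambda>i. s i n)" for n
  proof (rule Cauchy_convergent, rule metric_CauchyI)
    fix e :: real assume "e > 0"
    then have "w * e > 0" using w by simp
    then obtain I where I: "\<And>i j. i \<ge> I \<Longrightarrow> j \<ge> I \<Longrightarrow>
        norm_dist (fN_space p u k) (fN_norm p u k) (s i) (s j) < w * e"
      using Cauchy[OF \<open>w * e > 0\<close>] by blast
    have "dist (s i n) (s j n) < e" if "i \<ge> I" "j \<ge> I" for i j
    proof -
      have "dist (s i n) (s j n)
          \<le> inverse w * norm_dist (fN_space p u k) (fN_norm p u k) (s i) (s j)"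
        using coordinate_dist[OF s s] by (simp add: w_def)
      also have "\<dots> < e"
        using I[OF that] w by (simp add: field_simps)
      finally show ?thesis .
    qed
    then show "\<exists>I. \<forall>i\<ge>I. \<forall>j\<ge>I. dist (s i n) (s j n) < e" by blast
  qed
  then have "\<forall>n. \<exists>l. (\<lambda>i. s i n) \<longlonglongrightarrow> l"
    unfolding convergent_def by blast
  from choice[OF this] obtain a where a: "\<And>n. (\<lambda>i. s i n) \<longlonglongrightarrow> a n"
    by blast
  \<comment> \<open>Fix \<open>i\<close> and let \<open>j\<close> tend to infinity in the Cauchy
    bound for \<open>s j - s i\<close>. The result is phrased with \<open>Q\<close> because
    \<open>a\<close> is not yet known to lie in the space.\<close>
  have close: "\<exists>I. \<forall>i\<ge>I. \<forall>M n. Q {..<M} n (a - s i) \<le> e" if "e > 0" for e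
  proof -
    obtain I where I: "\<And>i j. i \<ge> I \<Longrightarrow> j \<ge> I \<Longrightarrow>
        norm_dist (fN_space p u k) (fN_norm p u k) (s i) (s j) < e"
      using Cauchy[OF \<open>e > 0\<close>] by blast
    have "Q {..<M} n (a - s i) \<le> e" if "i \<ge> I" for i M n
    proof (rule tendsto_upperbound)
      show "(\<lambda>j. Q {..<M} n (s j - s i)) \<longlonglongrightarrow> Q {..<M} n (a - s i)"
        by (rule tendsto_Q) (unfold minus_apply, intro tendsto_diff a tendsto_const)
      have "Q {..<M} n (s j - s i) \<le> e" if "j \<ge> I" for j
        using Q_le_fN_norm[OF diff_in_fN_space[OF s s], of M n j i] I[OF that \<open>i \<ge> I\<close>] s
        by (simp add: norm_dist_def)
      then show "\<forall>\<^sub>F j in sequentially. Q {..<M} n (s j - s i) \<le> e"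
        unfolding eventually_sequentially by blast
    qed simp
    then show ?thesis by blast
  qed
  have aX: "a \<in> fN_space p u k"
    unfolding fN_space_iff
  proof (intro allI impI)
    fix e :: real assume "e > 0"
    then have e: "e / 2 > 0" by simp
    obtain i where i: "\<And>M n. Q {..<M} n (a - s i) \<le> e / 2"
      using close[OF e] by blast
    obtain M where M: "\<And>M' n. Q {M..<M'} n (s i) \<le> e / 2"
      using s[of i] e unfolding fN_space_iff by blast
    \<comment> \<open>Split \<open>a\<close> as \<open>(a - s i) + s i\<close> with one fixed
      \<open>i\<close>: the first part is small on all blocks, the second on late ones.\<close>
    have "Q {M..<M'} n a \<le> e" for M' n
    proof -
      have "Q {M..<M'} n (a - s i) \<le> e / 2"
        by (rule order_trans[OF Q_mono i[of M' n]]) auto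
      then show ?thesis
        using Q_add_le[of "{M..<M'}" n "a - s i" "s i"] M[of M' n] by simp
    qed
    then show "\<exists>M. \<forall>M' n. Q {M..<M'} n a \<le> e" by blast
  qed
  have "limitin mtopology s a sequentially"
    unfolding limit_metric_sequentially
  proof (intro conjI allI impI aX)
    fix e :: real assume "e > 0"
    then have e: "e / 2 > 0" by simp
    obtain I where I: "\<And>i M n. i \<ge> I \<Longrightarrow> Q {..<M} n (a - s i) \<le> e / 2"
      using close[OF e] by blast
    have "norm_dist (fN_space p u k) (fN_norm p u k) (s i) a < e" if "i \<ge> I" for i
    proof -
      \<comment> \<open>Passing to the supremum keeps only a non-strict bound; using
        \<open>e / 2\<close> restores the strict one.\<close>
      have "fN_norm p u k (a - s i) \<le> e / 2"
        using I[OF that] e by (intro fN_norm_leI diff_in_fN_space aX s) simp_all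
      then have "norm_dist (fN_space p u k) (fN_norm p u k) a (s i) < e"
        using aX s \<open>e > 0\<close> by (simp add: norm_dist_def)
      then show ?thesis by (simp add: commute)
    qed
    then show "\<exists>I. \<forall>i\<ge>I. s i \<in> fN_space p u k \<and>
        norm_dist (fN_space p u k) (fN_norm p u k) (s i) a < e"
      using s by blast
  qed
  then show "\<exists>a. limitin mtopology s a sequentially"
    by blast
qed

end

theorem theorem2p4:
  fixes p u :: "nat \<Rightarrow> real" and k :: real
  assumes "\<And>m. p m > 0"
    and "filterlim (psum p) at_top sequentially"
    and "\<And>m. u m > 0"
    and "k \<ge> 1"
  shows "BK_space (fN_space p u k) (fN_norm p u k)"
proof -
  interpret riesz_weights p u k
    by unfold_locales (use assms in auto)
  show ?thesis
    unfolding BK_space_def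
    using subspace_fN_space norm_on_fN mcomplete_fN continuous_map_coordinate by blast
qed

end
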